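(* Let $T$ be a full binary tree on $n$ vertices, let $v_0v_1\cdots v_\ell$ be a longest root-to-leaf path of $T$ with $v_0$ the root, and suppose $f$ is a graceful labeling of $T$ that carries the alternating extreme spine assignment on this path, i.e. $f(v_i)=i/2$ for even $i$ and $f(v_i)=n-1-(i-1)/2$ for odd $i$ ($0\le i\le \ell$). Let $$a=\left\lceil\frac{\ell+1}{2}\right\rceil,\qquad b=\left\lfloor\frac{\ell+1}{2}\right\rfloor.$$ Then the set of labels used on the spine vertices $v_0,\dots,v_\ell$ is $$\{0,1,\dots,a-1\}\cup\{n-b,n-b+1,\dots,n-1\},$$ and the spine edges $v_iv_{i+1}$ ($0\le i<\ell$) use exactly the differences $\{n-\ell,n-\ell+1,\dots,n-1\}$. Consequently, all vertices not on the spine are labeled from the middle block $M=\{a,a+1,\dots,n-1-b\}$, and the edges not on the spine realize exactly the differences $\{1,2,\dots,n-\ell-1\}$.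
   Context: A graceful labeling of a tree $T$ with $n$ vertices is a bijection $f:V(T)\to\{0,1,\dots,n-1\}$ such that the set of induced edge labels (differences) $\{|f(u)-f(v)|: uv\in E(T)\}$ equals $\{1,2,\dots,n-1\}$. A full binary tree is a rooted tree in which every non-leaf vertex has exactly two children. Path length is the number of edges, so a root-to-leaf path of length $\ell$ has vertices $v_0,\dots,v_\ell$. The chosen longest root-to-leaf path is called the spine; its edges are the spine edges, and all other edges of $T$ are off-spine edges. *)

theory Defs
  imports Complex_Main
begin

text \<open>Finite simple graphs are given by a vertex set and a set of two-element edges. The
  digraph library Graph-Theory is not used: its trees only exclude directed cycles, and there
  \<open>u, v, u\<close> is a cycle in any symmetric digraph with an edge between \<open>u\<close> and \<open>v\<close>.\<close>

definition simple_graph :: "'a set \<Rightarrow> 'a set set \<Rightarrow> bool" where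
  "simple_graph V E \<longleftrightarrow> finite V \<and> (\<forall>e\<in>E. e \<subseteq> V \<and> card e = 2)"

definition path_edges :: "'a list \<Rightarrow> 'a set set" where
  "path_edges p = {{p ! i, p ! Suc i} | i. Suc i < length p}"

text \<open>A path is the list of its vertices; its length in edges is one less than the length of
  the list.\<close>

definition graph_path :: "'a set \<Rightarrow> 'a set set \<Rightarrow> 'a list \<Rightarrow> bool" where
  "graph_path V E p \<longleftrightarrow> p \<noteq> [] \<and> set p \<subseteq> V \<and> distinct p \<and> path_edges p \<subseteq> E"

definition graph_connected :: "'a set \<Rightarrow> 'a set set \<Rightarrow> bool" where
  "graph_connected V E \<longleftrightarrow>
     V \<noteq> {} \<and> (\<forall>u\<in>V. \<forall>v\<in>V. \<exists>p. graph_path V E p \<and> hd p = u \<and> last p = v)"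

definition graph_cycle :: "'a set \<Rightarrow> 'a set set \<Rightarrow> 'a list \<Rightarrow> bool" where
  "graph_cycle V E p \<longleftrightarrow> graph_path V E p \<and> length p \<ge> 3 \<and> {last p, hd p} \<in> E"

definition tree_graph :: "'a set \<Rightarrow> 'a set set \<Rightarrow> bool" where
  "tree_graph V E \<longleftrightarrow> simple_graph V E \<and> graph_connected V E \<and> \<not> (\<exists>p. graph_cycle V E p)"

text \<open>The parent of \<open>w\<close> is the vertex preceding \<open>w\<close> on the path from the root \<open>r\<close> to \<open>w\<close>.\<close>

definition children :: "'a set \<Rightarrow> 'a set set \<Rightarrow> 'a \<Rightarrow> 'a \<Rightarrow> 'a set" where
  "children V E r v = {w. \<exists>p. graph_path V E (p @ [v, w]) \<and> hd (p @ [v, w]) = r}"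

text \<open>Leaves are the childless vertices, so the root is a leaf only in the one-vertex tree.\<close>

definition tree_leaf :: "'a set \<Rightarrow> 'a set set \<Rightarrow> 'a \<Rightarrow> 'a \<Rightarrow> bool" where
  "tree_leaf V E r v \<longleftrightarrow> v \<in> V \<and> children V E r v = {}"

definition full_binary_tree :: "'a set \<Rightarrow> 'a set set \<Rightarrow> 'a \<Rightarrow> bool" where
  "full_binary_tree V E r \<longleftrightarrow>
     tree_graph V E \<and> r \<in> V \<and> (\<forall>v\<in>V. \<not> tree_leaf V E r v \<longrightarrow> card (children V E r v) = 2)"

definition root_leaf_path :: "'a set \<Rightarrow> 'a set set \<Rightarrow> 'a \<Rightarrow> 'a list \<Rightarrow> bool" where
  "root_leaf_path V E r p \<longleftrightarrow> graph_path V E p \<and> hd p = r \<and> tree_leaf V E r (last p)"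

definition longest_root_leaf_path :: "'a set \<Rightarrow> 'a set set \<Rightarrow> 'a \<Rightarrow> 'a list \<Rightarrow> bool" where
  "longest_root_leaf_path V E r p \<longleftrightarrow>
     root_leaf_path V E r p \<and> (\<forall>q. root_leaf_path V E r q \<longrightarrow> length q \<le> length p)"

text \<open>Labels are integers, so that no subtraction below is truncated.\<close>

definition edge_diffs :: "('a \<Rightarrow> int) \<Rightarrow> 'a set set \<Rightarrow> int set" where
  "edge_diffs f S = {\<bar>f u - f v\<bar> | u v. {u, v} \<in> S}"

definition graceful_labeling :: "'a set \<Rightarrow> 'a set set \<Rightarrow> ('a \<Rightarrow> int) \<Rightarrow> bool" where
  "graceful_labeling V E f \<longleftrightarrow>
     bij_betw f V {0..int (card V) - 1} \<and> edge_diffs f E = {1..int (card V) - 1}"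

definition alternating_extreme :: "nat \<Rightarrow> ('a \<Rightarrow> int) \<Rightarrow> 'a list \<Rightarrow> bool" where
  "alternating_extreme n f p \<longleftrightarrow>
     (\<forall>i < length p. f (p ! i) =
        (if even i then int i div 2 else int n - 1 - (int i - 1) div 2))"

end

theory Submission
  imports Defs
begin

text \<open>An acyclic graph has fewer edges than vertices, so the \<open>n - 1\<close> differences of a graceful
  labeling are attained by at most \<open>n - 1\<close> edges: the difference is injective on the edges. The
  spine edge \<open>v\<^sub>i v\<^sub>i\<^sub>+\<^sub>1\<close> has difference \<open>n - 1 - i\<close>, and by injectivity the remaining edges
  realize exactly the remaining differences.\<close>

section \<open>Counting the edges of acyclic graphs\<close>

lemma path_edges_Cons:
  assumes "p \<noteq> []"
  shows "path_edges (x # p) = insert {x, hd p} (path_edges p)"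
proof -
  have eq: "path_edges q = (\<lambda>i. {q ! i, q ! Suc i}) ` {i. Suc i < length q}" for q :: "'a list"
    by (auto simp: path_edges_def)
  have "{i. Suc i < length (x # p)} = insert 0 (Suc ` {i. Suc i < length p})"
    using assms by (auto simp: image_iff gr0_conv_Suc) (metis not0_implies_Suc)
  then show ?thesis
    using assms by (simp add: eq image_image hd_conv_nth)
qed

lemma path_edges_take_subset: "path_edges (take k p) \<subseteq> path_edges p"
  by (force simp: path_edges_def)

lemma graph_path_mono:
  assumes "graph_path W F p" "W \<subseteq> V" "F \<subseteq> E"
  shows "graph_path V E p"
  using assms unfolding graph_path_def by blast

lemma graph_cycle_mono:
  assumes "graph_cycle W F p" "W \<subseteq> V" "F \<subseteq> E"
  shows "graph_cycle V E p"
  using assms graph_path_mono unfolding graph_cycle_def by blast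

text \<open>The witness is the first vertex of a longest path: a second neighbour would extend the path
  or close a cycle.\<close>

lemma acyclic_ex_degree_le_1:
  assumes graph: "simple_graph V E" and ne: "V \<noteq> {}" and acyclic: "\<nexists>p. graph_cycle V E p"
  shows "\<exists>h\<in>V. card {e \<in> E. h \<in> e} \<le> 1"
proof -
  have fin: "finite V" using graph by (simp add: simple_graph_def)
  obtain x where "x \<in> V" using ne by blast
  then have "graph_path V E [x]" by (simp add: graph_path_def path_edges_def)
  moreover have "length p \<le> card V" if "graph_path V E p" for p
    using that fin unfolding graph_path_def by (metis card_mono distinct_card)
  ultimately have "\<exists>p. graph_path V E p \<and> (\<forall>q. graph_path V E q \<longrightarrow> length q \<le> length p)"
    by (intro ex_has_greatest_nat[where b = "Suc (card V)"]) (auto simp: less_Suc_eq_le)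
  then obtain p where p: "graph_path V E p"
    and longest: "\<And>q. graph_path V E q \<Longrightarrow> length q \<le> length p"
    by blast
  have p_ne: "p \<noteq> []" and dist: "distinct p" and sub: "set p \<subseteq> V" and pe: "path_edges p \<subseteq> E"
    using p by (auto simp: graph_path_def)
  let ?h = "hd p"
  \<comment> \<open>On a one-vertex path \<open>p ! 1\<close> is unspecified, but then no such
    \<open>e\<close> exists: its other end \<open>y\<close> lies on the path and differs from
    \<open>?h\<close>.\<close>
  have "e = {?h, p ! 1}" if e: "e \<in> E" "?h \<in> e" for e
  proof -
    have "card e = 2" "e \<subseteq> V" using graph e by (auto simp: simple_graph_def)
    then obtain y where y: "e = {y, ?h}" "y \<noteq> ?h" "y \<in> V"
      using e(2) by (metis card_2_iff doubleton_eq_iff insertE insert_subset singletonD)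
    have "y \<in> set p"
    proof (rule ccontr)
      assume "y \<notin> set p"
      then have "graph_path V E (y # p)"
        using p y e(1) by (simp add: graph_path_def path_edges_Cons)
      then show False using longest by fastforce
    qed
    then obtain k where k: "k < length p" "p ! k = y" by (auto simp: in_set_conv_nth)
    have "k \<noteq> 0" using k(2) y(2) p_ne by (metis hd_conv_nth)
    moreover have "\<not> 2 \<le> k"
    proof
      assume "2 \<le> k"
      \<comment> \<open>This prefix ends at index \<open>k\<close>, that is at \<open>y\<close>.
        From \<open>2 \<le> k\<close> it has at least three vertices, and \<open>e\<close> joins its
        two ends.\<close>
      let ?c = "take (Suc k) p"
      have "graph_path V E ?c"
        using p_ne dist sub pe path_edges_take_subset[of "Suc k" p] set_take_subset[of "Suc k" p]
        unfolding graph_path_def by auto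
      moreover have "last ?c = y" using k by (simp add: take_Suc_conv_app_nth)
      ultimately have "graph_cycle V E ?c"
        using \<open>2 \<le> k\<close> k(1) y(1) e(1) by (simp add: graph_cycle_def)
      then show False using acyclic by blast
    qed
    ultimately have "k = 1" by linarith
    then show ?thesis using k y(1) by (simp add: insert_commute)
  qed
  then have "{e \<in> E. ?h \<in> e} \<subseteq> {{?h, p ! 1}}" by blast
  then have "card {e \<in> E. ?h \<in> e} \<le> card {{?h, p ! 1}}" by (intro card_mono) auto
  then show ?thesis using sub p_ne by (intro bexI[of _ ?h]) auto
qed

lemma simple_graph_finite_edges:
  assumes "simple_graph V E"
  shows "finite E"
proof (rule finite_subset)
  show "E \<subseteq> Pow V" "finite (Pow V)" using assms by (auto simp: simple_graph_def)
qed

text \<open>Deleting a vertex of degree at most one costs one vertex and at most one edge.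
  Acyclicity passes to subgraphs at once, so for acyclic graphs instead of trees the induction never
  has to re-establish connectedness.\<close>

lemma acyclic_card_edges_less:
  assumes "simple_graph V E" "V \<noteq> {}" "\<nexists>p. graph_cycle V E p"
  shows "card E < card V"
  using assms
proof (induction "card V" arbitrary: V E)
  case 0
  then show ?case by (simp add: simple_graph_def)
next
  case (Suc m)
  have fin: "finite V" and "finite E"
    using Suc.prems(1) simple_graph_finite_edges by (auto simp: simple_graph_def)
  obtain h where h: "h \<in> V" "card {e \<in> E. h \<in> e} \<le> 1"
    using acyclic_ex_degree_le_1[OF Suc.prems] by blast
  define W where "W = V - {h}"
  define F where "F = {e \<in> E. h \<notin> e}"
  have card_W: "card W = m" using Suc.hyps(2) h fin by (simp add: W_def)
  have "E = F \<union> {e \<in> E. h \<in> e}" by (auto simp: F_def)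
  then have card_E: "card E \<le> card F + 1"
    using card_Un_le[of F "{e \<in> E. h \<in> e}"] h(2) by simp
  have graph: "simple_graph W F"
    using Suc.prems(1) by (auto simp: simple_graph_def W_def F_def)
  show ?case
  proof (cases "W = {}")
    \<comment> \<open>Here \<open>h\<close> is the only vertex, so the induction hypothesis does not
      apply. A subset of \<open>{h}\<close> has at most one element, hence there are no
      edges.\<close>
    case True
    have "F = {}" using graph True by (fastforce simp: simple_graph_def)
    have "e = {}" if "e \<in> E" for e
    proof -
      have "e \<subseteq> {h}" "card e = 2" using Suc.prems(1) True that by (auto simp: simple_graph_def W_def)
      then show ?thesis by (auto simp: subset_singleton_iff)
    qed
    then have "E = {}" using Suc.prems(1) by (fastforce simp: simple_graph_def)
    then show ?thesis using h fin by (auto simp: card_gt_0_iff)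
  next
    case False
    have "\<nexists>p. graph_cycle W F p"
      using Suc.prems(3) graph_cycle_mono[of W F _ V E] by (auto simp: W_def F_def)
    then have "card F < card W" using Suc.hyps(1) card_W graph False by metis
    then show ?thesis using card_E card_W Suc.hyps(2) by linarith
  qed
qed

section \<open>Differences as a function of the edge\<close>

text \<open>\<open>edge_diffs\<close> ranges over pairs of endpoints. Injectivity needs a function
  of the unordered edge, and maximum minus minimum gives one without choosing an order of the
  ends.\<close>

definition edge_diff :: "('a \<Rightarrow> int) \<Rightarrow> 'a set \<Rightarrow> int" where
  "edge_diff f e = Max (f ` e) - Min (f ` e)"

lemma edge_diff_doubleton: "edge_diff f {u, w} = \<bar>f u - f w\<bar>"
  by (simp add: edge_diff_def max_def min_def)

lemma edge_diffs_eq_image: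
  assumes "\<And>e. e \<in> S \<Longrightarrow> card e = 2"
  shows "edge_diffs f S = edge_diff f ` S"
proof
  show "edge_diffs f S \<subseteq> edge_diff f ` S"
    by (auto simp: edge_diffs_def edge_diff_doubleton[symmetric])
  show "edge_diff f ` S \<subseteq> edge_diffs f S"
  proof
    fix d assume "d \<in> edge_diff f ` S"
    then obtain e where "e \<in> S" "d = edge_diff f e" by blast
    moreover obtain u w where "e = {u, w}" using assms[OF \<open>e \<in> S\<close>] by (auto simp: card_2_iff)
    ultimately show "d \<in> edge_diffs f S" by (auto simp: edge_diffs_def edge_diff_doubleton)
  qed
qed

text \<open>\<open>graceful_labeling\<close> only equates two sets of differences. Injectivity is
  what makes the removal of the spine edges remove their differences as well.\<close>

lemma inj_on_edge_diff:
  assumes tree: "tree_graph V E" and graceful: "graceful_labeling V E f"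
  shows "inj_on (edge_diff f) E"
proof (rule eq_card_imp_inj_on)
  have graph: "simple_graph V E" and ne: "V \<noteq> {}" and acyclic: "\<nexists>p. graph_cycle V E p"
    using tree by (auto simp: tree_graph_def graph_connected_def)
  show "finite E" using graph by (rule simple_graph_finite_edges)
  have "edge_diff f ` E = {1..int (card V) - 1}"
    using edge_diffs_eq_image[of E f] graph graceful
    by (simp add: graceful_labeling_def simple_graph_def)
  then have "card (edge_diff f ` E) = card V - 1" by simp
  \<comment> \<open>The count is squeezed: \<open>card V - 1\<close> differences, no more
    differences than edges, and fewer edges than vertices.\<close>
  then show "card (edge_diff f ` E) = card E"
    using acyclic_card_edges_less[OF graph ne acyclic] card_image_le[OF \<open>finite E\<close>, of "edge_diff f"]
    by linarith
qed

section \<open>Labels and differences along the spine\<close>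

lemma alternating_extreme_edge_diff:
  assumes "alternating_extreme n f p" "Suc i < length p" "Suc i < n"
  shows "edge_diff f {p ! i, p ! Suc i} = int n - 1 - int i"
proof -
  have "f (p ! i) = (if even i then int i div 2 else int n - 1 - (int i - 1) div 2)"
    "f (p ! Suc i) = (if even i then int n - 1 - int i div 2 else (int i + 1) div 2)"
    using assms by (auto simp: alternating_extreme_def algebra_simps)
  \<comment> \<open>The two labels are \<open>k\<close> and \<open>n - 1 - k\<close> for
    \<open>i = 2 * k\<close>, and \<open>n - 1 - k\<close> and \<open>k + 1\<close> for
    \<open>i = 2 * k + 1\<close>. By \<open>Suc i < n\<close> the high label is the larger one,
    which resolves the absolute value.\<close>
  moreover obtain k where "i = 2 * k \<or> i = 2 * k + 1" by (metis evenE oddE)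
  ultimately show ?thesis
    using assms(3) unfolding edge_diff_doubleton by auto
qed

lemma alternating_extreme_edge_diffs:
  assumes alt: "alternating_extreme n f p" and len: "length p = Suc l" and "l < n"
  shows "edge_diff f ` path_edges p = {int n - int l..int n - 1}"
proof -
  have "path_edges p = (\<lambda>i. {p ! i, p ! Suc i}) ` {..<l}"
    by (auto simp: path_edges_def len)
  then have "edge_diff f ` path_edges p = (\<lambda>i. edge_diff f {p ! i, p ! Suc i}) ` {..<l}"
    by (simp add: image_image)
  also have "\<dots> = (\<lambda>i. int n - 1 - int i) ` {..<l}"
    using alternating_extreme_edge_diff[OF alt] len \<open>l < n\<close> by (intro image_cong) auto
  also have "\<dots> = {int n - int l..int n - 1}"
  proof
    show "{int n - int l..int n - 1} \<subseteq> (\<lambda>i. int n - 1 - int i) ` {..<l}"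
    proof
      fix d assume "d \<in> {int n - int l..int n - 1}"
      then show "d \<in> (\<lambda>i. int n - 1 - int i) ` {..<l}"
        by (intro image_eqI[of _ _ "nat (int n - 1 - d)"]) auto
    qed
  qed auto
  finally show ?thesis .
qed

text \<open>The indices up to \<open>l\<close> comprise \<open>(l + 2) div 2\<close> even and
  \<open>(l + 1) div 2\<close> odd ones. The even ones count upwards from 0, the odd ones downwards
  from \<open>n - 1\<close>.\<close>

lemma alternating_extreme_labels:
  assumes alt: "alternating_extreme n f p" and len: "length p = Suc l"
  shows "f ` set p = {0..(int l + 2) div 2 - 1} \<union> {int n - (int l + 1) div 2..int n - 1}"
    (is "_ = ?low \<union> ?high")
proof
  have f_nth: "f (p ! i) = (if even i then int i div 2 else int n - 1 - (int i - 1) div 2)"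
    if "i \<le> l" for i
    using alt that by (simp add: alternating_extreme_def len)
  show "f ` set p \<subseteq> ?low \<union> ?high"
  proof
    fix x assume "x \<in> f ` set p"
    then obtain i where "i \<le> l" "x = f (p ! i)" by (auto simp: in_set_conv_nth len less_Suc_eq_le)
    moreover obtain k where "i = 2 * k \<or> i = 2 * k + 1" by (metis evenE oddE)
    ultimately show "x \<in> ?low \<union> ?high" using f_nth[of i] by auto
  qed
  have label: "f (p ! i) \<in> f ` set p" if "i \<le> l" for i
    using that by (simp add: len)
  show "?low \<union> ?high \<subseteq> f ` set p"
  proof
    fix x assume "x \<in> ?low \<union> ?high"
    then show "x \<in> f ` set p"
    proof
      assume "x \<in> ?low"
      then have "2 * nat x \<le> l" "f (p ! (2 * nat x)) = x"
        using f_nth[of "2 * nat x"] by auto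
      then show ?thesis using label by metis
    next
      assume x: "x \<in> ?high"
      \<comment> \<open>This is the odd index solving
        \<open>n - 1 - (i - 1) div 2 = x\<close>.\<close>
      let ?i = "2 * nat (int n - 1 - x) + 1"
      have "?i \<le> l" using x by auto
      moreover have "f (p ! ?i) = x" using f_nth[OF \<open>?i \<le> l\<close>] x by auto
      ultimately show ?thesis using label by metis
    qed
  qed
qed

lemma ceiling_half: "\<lceil>(real l + 1) / 2\<rceil> = (int l + 2) div 2"
proof -
  obtain k where "l = 2 * k \<or> l = 2 * k + 1" by (metis evenE oddE)
  then show ?thesis by (intro ceiling_unique) auto
qed

lemma floor_half: "\<lfloor>(real l + 1) / 2\<rfloor> = (int l + 1) div 2"
proof -
  obtain k where "l = 2 * k \<or> l = 2 * k + 1" by (metis evenE oddE)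
  then show ?thesis by (intro floor_unique) auto
qed

theorem lemma2p3:
  fixes V :: "'a set" and E :: "'a set set" and r :: 'a
    and n l :: nat and v :: "'a list" and f :: "'a \<Rightarrow> int" and a b :: int
  assumes "full_binary_tree V E r"
    and "card V = n"
    and "longest_root_leaf_path V E r v"
    and "length v = l + 1"
    and "graceful_labeling V E f"
    and "alternating_extreme n f v"
    and "a = \<lceil>(real l + 1) / 2\<rceil>"
    and "b = \<lfloor>(real l + 1) / 2\<rfloor>"
  shows "f ` set v = {0..a - 1} \<union> {int n - b..int n - 1}
       \<and> edge_diffs f (path_edges v) = {int n - int l..int n - 1}
       \<and> f ` (V - set v) \<subseteq> {a..int n - 1 - b}
       \<and> edge_diffs f (E - path_edges v) = {1..int n - int l - 1}"
proof -
  have tree: "tree_graph V E" using assms(1) by (simp add: full_binary_tree_def)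
  then have fin: "finite V" and edge: "\<And>e. e \<in> E \<Longrightarrow> card e = 2"
    by (auto simp: tree_graph_def simple_graph_def)
  have path: "set v \<subseteq> V" "distinct v" "path_edges v \<subseteq> E"
    using assms(3) by (auto simp: longest_root_leaf_path_def root_leaf_path_def graph_path_def)
  \<comment> \<open>The spine has \<open>l + 1\<close> distinct vertices, all in
    \<open>V\<close>.\<close>
  have "l < n"
    using card_mono[OF fin path(1)] distinct_card[OF path(2)] assms(2,4) by simp
  have inj: "inj_on f V" and image: "f ` V = {0..int n - 1}"
    and diffs: "edge_diffs f E = {1..int n - 1}"
    using assms(2,5) by (auto simp: graceful_labeling_def bij_betw_def)
  have labels: "f ` set v = {0..a - 1} \<union> {int n - b..int n - 1}"
    using alternating_extreme_labels[OF assms(6)] assms(4,7,8)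
    by (simp add: ceiling_half floor_half)
  have spine: "edge_diff f ` path_edges v = {int n - int l..int n - 1}"
    using alternating_extreme_edge_diffs[OF assms(6)] assms(4) \<open>l < n\<close> by simp
  \<comment> \<open>By injectivity the off-spine labels are the complement of the two extreme blocks
    in \<open>{0..n - 1}\<close>.\<close>
  have "f ` (V - set v) = f ` V - f ` set v"
    using inj path(1) by (rule inj_on_image_set_diff[OF _ Diff_subset])
  then have middle: "f ` (V - set v) \<subseteq> {a..int n - 1 - b}"
    using labels image by auto
  \<comment> \<open>The same argument for edges, with \<open>edge_diff f\<close> injective on
    \<open>E\<close>.\<close>
  have "edge_diff f ` (E - path_edges v) = edge_diff f ` E - edge_diff f ` path_edges v"
    by (rule inj_on_image_set_diff[OF inj_on_edge_diff[OF tree assms(5)] Diff_subset path(3)])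
  also have "\<dots> = {1..int n - 1} - {int n - int l..int n - 1}"
    using spine diffs edge_diffs_eq_image[of E f] edge by simp
  also have "\<dots> = {1..int n - int l - 1}" by auto
  finally have "edge_diffs f (E - path_edges v) = {1..int n - int l - 1}"
    using edge_diffs_eq_image[of "E - path_edges v" f] edge by simp
  moreover have "edge_diffs f (path_edges v) = {int n - int l..int n - 1}"
    using edge_diffs_eq_image[of "path_edges v" f] edge path(3) spine by blast
  ultimately show ?thesis using labels middle by blast
qed

end
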